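(* Let $p$ be a prime and let $G$ be a subgroup of $N_s(p)$ such that $\det(G) = (\mathbb{Z}/p\mathbb{Z})^\times$ and $G' = [G,G]\neq \{\mathrm{Id}\}$. Then $G/G'$ is isomorphic to $(\mathbb{Z}/p\mathbb{Z})^\times$, or to $(\mathbb{Z}/p\mathbb{Z})^\times \times \mathbb{Z}/2\mathbb{Z}$, or to $\mathbb{Z}/2(p-1)\mathbb{Z}$. Moreover, if $G$ contains an element of trace zero and determinant $-1$, then $G/G'\simeq (\mathbb{Z}/p\mathbb{Z})^\times$ or $G/G'\simeq(\mathbb{Z}/p\mathbb{Z})^\times\times \mathbb{Z}/2\mathbb{Z}$.
   Context: The split Cartan subgroup of $\operatorname{GL}(2,\mathbb{Z}/p\mathbb{Z})$ is $C_s(p) = \left\{\begin{pmatrix}a&0\\0&b \end{pmatrix}: a,b\in(\mathbb{Z}/p\mathbb{Z})^\times \right\}$, and its normalizer is $N_s(p) = C_s(p) \cup \begin{pmatrix}0&1\\1&0\end{pmatrix} C_s(p)$. *)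

theory Defs
  imports
    "HOL-Analysis.Determinants"
    "HOL-Algebra.Elementary_Groups"
    "HOL-Algebra.Generated_Groups"
    "Berlekamp_Zassenhaus.Finite_Field"
begin

text \<open>
  The ring of integers modulo \<open>p\<close> is the type \<open>'p mod_ring\<close>, where
  \<open>'p :: prime_card\<close> is a type with a prime number \<open>p = CARD('p)\<close> of elements.
\<close>

definition unit_group :: "'a::comm_ring_1 monoid" where
  "unit_group = \<lparr>carrier = {a. a dvd 1}, mult = (*), one = 1\<rparr>"

definition GL2 :: "('a::comm_ring_1 ^ 2 ^ 2) monoid" where
  "GL2 = \<lparr>carrier = {A. invertible A}, mult = (**), one = mat 1\<rparr>"

definition split_cartan :: "('a::comm_ring_1 ^ 2 ^ 2) set" where
  "split_cartan = {vector [vector [a, 0], vector [0, b]] | a b.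
     a \<in> carrier unit_group \<and> b \<in> carrier unit_group}"

text \<open>
  This is the explicit union, which is the group-theoretic normalizer of \<open>split_cartan\<close>
  in \<open>GL2\<close> over the integers modulo \<open>p\<close> only for \<open>p \<noteq> 2\<close>.
\<close>

definition split_cartan_normalizer :: "('a::comm_ring_1 ^ 2 ^ 2) set" where
  "split_cartan_normalizer =
     split_cartan \<union> (\<lambda>A. vector [vector [0, 1], vector [1, 0]] ** A) ` split_cartan"

end

theory Submission
  imports Defs "HOL-Algebra.Multiplicative_Group"
begin

text \<open>
  Let \<open>C\<close> be the diagonal part of \<open>G\<close> and \<open>\<gamma>\<close> an antidiagonal element of \<open>G\<close>, which exists because
  \<open>G\<close> is not abelian. A diagonal matrix \<open>c\<close> is determined by its lower right entry and its
  commutator with \<open>\<gamma>\<close>, so \<open>|G| \<le> 2 |C| \<le> 2 (p - 1) |G'|\<close>. Hence the surjection from \<open>G / G'\<close>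
  to the units induced by the determinant has a kernel of order 1 or 2. If the order is 2, then,
  the group of units being cyclic, the extension either splits or is cyclic of order
  \<open>2 (p - 1)\<close>; in the cyclic case the only involution lies in the kernel. An element of trace 0
  and determinant \<open>-1\<close> squares to the identity, and its class is not in the kernel as \<open>p \<noteq> 2\<close>.
\<close>

section \<open>Finite cyclic groups and their extensions by a group of order two\<close>

lemma (in group) ord_generator:
  assumes "a \<in> carrier G" "carrier G = range (\<lambda>i::int. a [^] i)"
  shows "ord a = Coset.order G"
proof -
  have "generate G {a} = carrier G"
    using generate_pow[OF assms(1)] assms(2) by auto
  then show ?thesis
    by (simp add: generate_pow_card[OF assms(1)] Coset.order_def)
qed

text \<open>Powers of a generator \<open>a\<close> depend exactly on the exponent modulo the group
  order, so exponentiation restricted to residues is an isomorphism.\<close>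

lemma (in group) cyclic_iso_integer_mod_group:
  assumes "finite (carrier G)" "cyclic_group G"
  shows "G \<cong> integer_mod_group (Coset.order G)"
proof -
  obtain a where a: "a \<in> carrier G" and gen: "carrier G = range (\<lambda>i::int. a [^] i)"
    using assms(2) cyclic_group by auto
  \<comment> \<open>Positivity matters, since \<open>integer_mod_group 0\<close> is the group of all
    integers.\<close>
  have N: "Coset.order G > 0"
    using assms(1) order_gt_0_iff_finite by blast
  have pow_eq: "a [^] i = a [^] j \<longleftrightarrow> i mod int (Coset.order G) = j mod int (Coset.order G)" for i j :: int
    using int_pow_eq[OF a, of i j] ord_generator[OF a gen]
    by (metis mod_eq_dvd_iff)
  have "(\<lambda>i::int. a [^] i) \<in> iso (integer_mod_group (Coset.order G)) G"
  proof (rule isoI)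
    show "(\<lambda>i::int. a [^] i) \<in> hom (integer_mod_group (Coset.order G)) G"
      using a by (auto simp: hom_def pow_eq simp flip: int_pow_mult)
    show "bij_betw (\<lambda>i::int. a [^] i) (carrier (integer_mod_group (Coset.order G))) (carrier G)"
    proof (rule bij_betw_imageI)
      show "inj_on (\<lambda>i::int. a [^] i) (carrier (integer_mod_group (Coset.order G)))"
        using N by (auto simp: inj_on_def pow_eq carrier_integer_mod_group)
      have "a [^] i = a [^] (i mod int (Coset.order G))" for i :: int
        by (simp add: pow_eq)
      then have "a [^] i \<in> (\<lambda>i::int. a [^] i) ` {0..<int (Coset.order G)}" for i :: int
        using N by (metis atLeastLessThan_iff image_eqI of_nat_0_less_iff pos_mod_bound pos_mod_sign)
      then show "(\<lambda>i::int. a [^] i) ` carrier (integer_mod_group (Coset.order G)) = carrier G"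
        using N a by (auto simp: carrier_integer_mod_group gen)
    qed
  qed
  then show ?thesis
    using group.iso_sym[OF group_integer_mod_group] by (auto simp: is_iso_def)
qed

text \<open>The first isomorphism theorem combined with Lagrange's theorem.\<close>

lemma (in group_hom) card_kernel_mult_order:
  assumes "h ` carrier G = carrier H"
  shows "card (kernel G H h) * Coset.order H = Coset.order G"
proof -
  have "card (carrier (G Mod kernel G H h)) = Coset.order H"
    using FactGroup_iso_set[OF assms] by (auto simp: iso_def Coset.order_def bij_betw_same_card)
  then show ?thesis
    using G.lagrange[OF subgroup_kernel] by (simp add: FactGroup_def mult.commute)
qed

text \<open>Lift a generator of \<open>U\<close> to \<open>a\<close>. Either the powers of
  \<open>a\<close> contain the kernel and exhaust \<open>A\<close>, or they form a complement to it.
  The clause on involutions is attached to the cyclic alternative so that a suitable involution can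
  later exclude it.\<close>

lemma cyclic_extension_of_order_two:
  assumes "comm_group A" "group_hom A U \<phi>" "\<phi> ` carrier A = carrier U"
    and "finite (carrier U)" "cyclic_group U" "card (kernel A U \<phi>) = 2"
  shows "A \<cong> U \<times>\<times> integer_mod_group 2 \<or>
    A \<cong> integer_mod_group (2 * Coset.order U) \<and>
    (\<forall>x\<in>carrier A. x \<otimes>\<^bsub>A\<^esub> x = \<one>\<^bsub>A\<^esub> \<longrightarrow> \<phi> x = \<one>\<^bsub>U\<^esub>)"
proof -
  interpret comm_group A by fact
  interpret \<phi>: group_hom A U \<phi> by fact
  let ?n = "Coset.order U"
  have n: "?n > 0"
    using assms(4) \<phi>.H.order_gt_0_iff_finite by blast
  have ordA: "Coset.order A = 2 * ?n"
    using \<phi>.card_kernel_mult_order[OF assms(3)] assms(6) by simp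
  then have finA: "finite (carrier A)"
    using n order_gt_0_iff_finite by auto
  obtain u where u: "u \<in> carrier U" and gen: "carrier U = range (\<lambda>i::int. u [^]\<^bsub>U\<^esub> i)"
    using assms(5) \<phi>.H.cyclic_group by auto
  obtain a where a: "a \<in> carrier A" "\<phi> a = u"
    using u assms(3) by (metis imageE)
  have "\<one>\<^bsub>A\<^esub> \<in> kernel A U \<phi>"
    by (simp add: kernel_def)
  then obtain k where ker: "kernel A U \<phi> = {\<one>\<^bsub>A\<^esub>, k}" and k1: "k \<noteq> \<one>\<^bsub>A\<^esub>"
    using assms(6) unfolding card_2_iff by (metis insertE insert_commute singletonD)
  then have k: "k \<in> carrier A" "\<phi> k = \<one>\<^bsub>U\<^esub>"
    by (auto simp: kernel_def)
  \<comment> \<open>The square stays in the two-element kernel, and it cannot be \<open>k\<close>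
    without forcing \<open>k\<close> to be the identity.\<close>
  have kk: "k \<otimes>\<^bsub>A\<^esub> k = \<one>\<^bsub>A\<^esub>"
  proof -
    have "k \<otimes>\<^bsub>A\<^esub> k \<in> kernel A U \<phi>"
      using k by (simp add: kernel_def)
    then show ?thesis
      using ker k k1 by (metis insertE l_cancel_one singletonD)
  qed
  define S where "S = range (\<lambda>i::int. a [^]\<^bsub>A\<^esub> i)"
  have S: "subgroup S A"
    unfolding S_def by (rule subgroup_of_powers[OF a(1)])
  have S_onto: "\<exists>s\<in>S. \<phi> s = v" if "v \<in> carrier U" for v
    using that a by (auto simp: S_def gen \<phi>.hom_int_pow)
  \<comment> \<open>An element of \<open>S\<close> with the same image as \<open>x\<close> differs
    from \<open>x\<close> by an element of the kernel.\<close>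
  have decomp: "\<exists>s\<in>S. x = s \<or> x = k \<otimes>\<^bsub>A\<^esub> s" if x: "x \<in> carrier A" for x
  proof -
    obtain s where s: "s \<in> S" "\<phi> s = \<phi> x"
      using S_onto x by (meson \<phi>.hom_closed)
    have sA: "s \<in> carrier A"
      using s S subgroup.mem_carrier by metis
    have "x \<otimes>\<^bsub>A\<^esub> inv\<^bsub>A\<^esub> s \<in> kernel A U \<phi>"
      using x sA s by (simp add: kernel_def)
    then have "x \<otimes>\<^bsub>A\<^esub> inv\<^bsub>A\<^esub> s = \<one>\<^bsub>A\<^esub> \<or> x \<otimes>\<^bsub>A\<^esub> inv\<^bsub>A\<^esub> s = k"
      using ker by auto
    then show ?thesis
      using x sA s k by (metis inv_solve_right' l_one one_closed)
  qed
  show ?thesis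
  proof (cases "k \<in> S")
    case True
    then have "carrier A = S"
      using decomp S by (metis subgroup.m_closed subgroup.subset subsetI subset_antisym)
    then have genA: "carrier A = range (\<lambda>i::int. a [^]\<^bsub>A\<^esub> i)"
      by (simp add: S_def)
    have "\<phi> x = \<one>\<^bsub>U\<^esub>" if x: "x \<in> carrier A" "x \<otimes>\<^bsub>A\<^esub> x = \<one>\<^bsub>A\<^esub>" for x
    proof -
      obtain i :: int where i: "x = a [^]\<^bsub>A\<^esub> i"
        using x genA by auto
      have "a [^]\<^bsub>A\<^esub> (i + i) = \<one>\<^bsub>A\<^esub>"
        by (metis i int_pow_mult a(1) x(2))
      \<comment> \<open>Here \<open>a\<close> generates \<open>A\<close>, so its order is
        \<open>2 * ?n\<close>; halving gives \<open>?n dvd i\<close>, whence the image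
        \<open>u\<close> to the power \<open>i\<close> is trivial.\<close>
      then have "int (2 * ?n) dvd i + i"
        using int_pow_eq_id[OF a(1)] ord_generator[OF a(1) genA] ordA by simp
      then have "int ?n dvd i"
        by (simp add: mult_2[symmetric])
      then show ?thesis
        using a u by (simp add: i \<phi>.hom_int_pow \<phi>.H.int_pow_eq_id \<phi>.H.ord_generator[OF u gen])
    qed
    moreover have "cyclic_group A"
      using cyclic_group a(1) genA by blast
    ultimately show ?thesis
      using cyclic_iso_integer_mod_group[OF finA] ordA by auto
  next
    case False
    \<comment> \<open>The second coordinate records which of the two cosets of \<open>S\<close>,
      namely \<open>S\<close> or \<open>k\<close> times \<open>S\<close>, contains
      \<open>x\<close>.\<close>
    let ?f = "\<lambda>x. (\<phi> x, if x \<in> S then 0 else 1 :: int)"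
    have kS: "k \<otimes>\<^bsub>A\<^esub> s \<notin> S" if "s \<in> S" for s
      using False that S k by (metis subgroup.mem_carrier subgroup.m_closed subgroup.m_inv_closed inv_solve_right')
    have "?f \<in> iso A (U \<times>\<times> integer_mod_group 2)"
      unfolding iso_kernel_image[OF group_axioms DirProd_group[OF \<phi>.H.group_axioms group_integer_mod_group]]
    proof (intro conjI)
      show "?f \<in> hom A (U \<times>\<times> integer_mod_group 2)"
      proof (rule homI)
        fix x y assume xy: "x \<in> carrier A" "y \<in> carrier A"
        obtain s where s: "s \<in> S" "x = s \<or> x = k \<otimes>\<^bsub>A\<^esub> s" using decomp xy by blast
        obtain t where t: "t \<in> S" "y = t \<or> y = k \<otimes>\<^bsub>A\<^esub> t" using decomp xy by blast
        have st: "s \<in> carrier A" "t \<in> carrier A" "s \<otimes>\<^bsub>A\<^esub> t \<in> S"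
          using s t S by (auto intro: subgroup.mem_carrier subgroup.m_closed)
        have "(k \<otimes>\<^bsub>A\<^esub> s) \<otimes>\<^bsub>A\<^esub> (k \<otimes>\<^bsub>A\<^esub> t) = (k \<otimes>\<^bsub>A\<^esub> k) \<otimes>\<^bsub>A\<^esub> (s \<otimes>\<^bsub>A\<^esub> t)"
          "s \<otimes>\<^bsub>A\<^esub> (k \<otimes>\<^bsub>A\<^esub> t) = k \<otimes>\<^bsub>A\<^esub> (s \<otimes>\<^bsub>A\<^esub> t)"
          "(k \<otimes>\<^bsub>A\<^esub> s) \<otimes>\<^bsub>A\<^esub> t = k \<otimes>\<^bsub>A\<^esub> (s \<otimes>\<^bsub>A\<^esub> t)"
          using st k by (simp_all add: m_ac)
        then show "?f (x \<otimes>\<^bsub>A\<^esub> y) = ?f x \<otimes>\<^bsub>U \<times>\<times> integer_mod_group 2\<^esub> ?f y"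
          using xy s t st kS k kk by auto
      qed (auto simp: carrier_integer_mod_group)
      show "kernel A (U \<times>\<times> integer_mod_group 2) ?f = {\<one>\<^bsub>A\<^esub>}"
      proof -
        have "x = \<one>\<^bsub>A\<^esub>" if "x \<in> carrier A" "\<phi> x = \<one>\<^bsub>U\<^esub>" "x \<in> S" for x
        proof -
          have "x \<in> kernel A U \<phi>"
            using that by (simp add: kernel_def)
          then show ?thesis
            using that False ker by auto
        qed
        then show ?thesis
          using S by (auto simp: kernel_def subgroup.one_closed split: if_splits)
      qed
      show "?f ` carrier A = carrier (U \<times>\<times> integer_mod_group 2)"
      proof
        show "?f ` carrier A \<subseteq> carrier (U \<times>\<times> integer_mod_group 2)"
          by (auto simp: carrier_integer_mod_group)
        show "carrier (U \<times>\<times> integer_mod_group 2) \<subseteq> ?f ` carrier A"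
        proof
          fix w assume "w \<in> carrier (U \<times>\<times> integer_mod_group 2)"
          then obtain v e where w: "w = (v, e)" "v \<in> carrier U" "e = 0 \<or> e = 1"
            by (fastforce simp: carrier_integer_mod_group)
          obtain s where s: "s \<in> S" "\<phi> s = v"
            using S_onto w by blast
          have "s \<in> carrier A" using s S subgroup.mem_carrier by metis
          \<comment> \<open>Multiplying by \<open>k\<close> switches the coset and leaves the image
            under \<open>\<phi>\<close> unchanged.\<close>
          then have "w = ?f (if e = 0 then s else k \<otimes>\<^bsub>A\<^esub> s)" "(if e = 0 then s else k \<otimes>\<^bsub>A\<^esub> s) \<in> carrier A"
            using w s k kS by auto
          then show "w \<in> ?f ` carrier A"
            by blast
        qed
      qed
    qed
    then show ?thesis
      by (auto simp: is_iso_def)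
  qed
qed

section \<open>The groups of units and of invertible matrices\<close>

lemma comm_group_unit_group: "comm_group (unit_group :: 'a::comm_ring_1 monoid)"
proof (rule comm_groupI)
  fix x :: 'a assume "x \<in> carrier unit_group"
  then obtain y where "1 = x * y"
    by (auto simp: unit_group_def elim: dvdE)
  then show "\<exists>y\<in>carrier unit_group. y \<otimes>\<^bsub>unit_group\<^esub> x = \<one>\<^bsub>unit_group\<^esub>"
    by (auto simp: unit_group_def mult.commute intro!: exI[of _ y]) (metis dvd_triv_right)
qed (auto simp: unit_group_def mult.assoc mult.commute is_unit_mult_iff)

lemma group_GL2: "group (GL2 :: ('a::comm_ring_1 ^ 2 ^ 2) monoid)"
proof (rule groupI)
  fix A B :: "'a ^ 2 ^ 2"
  assume "A \<in> carrier GL2"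
  then obtain A' where A': "A ** A' = mat 1" "A' ** A = mat 1"
    by (auto simp: GL2_def invertible_def)
  then show "\<exists>y\<in>carrier GL2. y \<otimes>\<^bsub>GL2\<^esub> A = \<one>\<^bsub>GL2\<^esub>"
    by (auto simp: GL2_def invertible_def)
  assume "B \<in> carrier GL2"
  then obtain B' where B': "B ** B' = mat 1" "B' ** B = mat 1"
    by (auto simp: GL2_def invertible_def)
  have "A ** B ** (B' ** A') = mat 1" "B' ** A' ** (A ** B) = mat 1"
    using A' B' by (metis matrix_mul_assoc matrix_mul_rid)+
  then show "A \<otimes>\<^bsub>GL2\<^esub> B \<in> carrier GL2"
    by (auto simp: GL2_def invertible_def)
qed (auto simp: GL2_def matrix_mul_assoc intro: invertible_def[THEN iffD2])

lemma cyclic_unit_group: "cyclic_group (unit_group :: 'a::{field,finite} monoid)"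
proof -
  \<comment> \<open>The cyclicity of the multiplicative group of a finite field is stated for ring
    records, so the type is repackaged as one.\<close>
  define R :: "'a ring" where "R = \<lparr>carrier = UNIV, mult = (*), one = 1, zero = 0, add = (+)\<rparr>"
  have inv: "\<exists>y. x + y = 0" for x :: 'a
    by (rule exI[of _ "- x"]) simp
  have inv': "x \<noteq> 0 \<Longrightarrow> \<exists>y. x * y = 1" for x :: 'a
    by (rule exI[of _ "inverse x"]) simp
  have "cring R"
    by (rule cringI; (rule abelian_groupI comm_monoidI)?) (auto simp: R_def algebra_simps inv)
  then interpret R: field R
    by (rule cring.cring_fieldI2) (auto simp: R_def inv')
  interpret U: comm_group "unit_group :: 'a monoid"
    by (rule comm_group_unit_group)
  have R_fin: "finite (carrier R)"
    by simp
  have U: "carrier unit_group = carrier (mult_of R)"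
    by (auto simp: unit_group_def R_def dvd_field_iff)
  obtain a where a: "a \<in> carrier (mult_of R)"
      "carrier (mult_of R) = {a [^]\<^bsub>R\<^esub> i | i::nat. i \<in> UNIV}"
    using R.finite_field_mult_group_has_gen[OF R_fin] by blast
  have pow: "a [^]\<^bsub>R\<^esub> i = a [^]\<^bsub>unit_group\<^esub> i" for i :: nat
    by (induction i) (auto simp: R_def unit_group_def nat_pow_def)
  have "carrier unit_group = range (\<lambda>i::int. a [^]\<^bsub>unit_group\<^esub> i)"
  proof
    show "carrier unit_group \<subseteq> range (\<lambda>i::int. a [^]\<^bsub>unit_group\<^esub> i)"
      unfolding U a(2) pow by (auto simp flip: int_pow_int)
  qed (use U a(1) in auto)
  then show ?thesis
    using U.cyclic_group a(1) unfolding U[symmetric] by blast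
qed

section \<open>Two-by-two matrices and the Cartan subgroup by entries\<close>

lemma matrix_2_eq_iff: "A = B \<longleftrightarrow> A $ 1 $ 1 = B $ 1 $ 1 \<and> A $ 1 $ 2 = B $ 1 $ 2 \<and>
    A $ 2 $ 1 = B $ 2 $ 1 \<and> A $ 2 $ 2 = B $ 2 $ 2"
  for A B :: "'a ^ 2 ^ 2"
  by (auto simp: vec_eq_iff forall_2)

lemma matrix_mult_2_nth:
  "(A ** B) $ i $ j = A $ i $ 1 * B $ 1 $ j + A $ i $ 2 * B $ 2 $ j"
  for A B :: "'a::comm_ring_1 ^ 2 ^ 2"
  by (simp add: matrix_matrix_mult_def sum_2)

text \<open>An instance of Cayley-Hamilton: the square of \<open>A\<close> is \<open>trace A\<close>
  times \<open>A\<close> minus \<open>det A\<close>. It is checked here on entries.\<close>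

lemma square_eq_one_of_trace_det:
  fixes A :: "'a::comm_ring_1 ^ 2 ^ 2"
  assumes "trace A = 0" "det A = - 1"
  shows "A ** A = mat 1"
proof -
  have 1: "A $ 2 $ 2 = - A $ 1 $ 1"
    using assms(1) by (simp add: trace_def sum_2 eq_neg_iff_add_eq_0 add.commute)
  have "- (A $ 1 $ 1 * A $ 1 $ 1 + A $ 1 $ 2 * A $ 2 $ 1) = - 1"
    using assms(2) by (simp add: det_2 1)
  then have "A $ 1 $ 1 * A $ 1 $ 1 + A $ 1 $ 2 * A $ 2 $ 1 = 1"
    by (simp only: neg_equal_iff_equal)
  then show ?thesis
    using 1 by (simp add: matrix_2_eq_iff matrix_mult_2_nth mat_def algebra_simps)
qed

lemma split_cartan_iff:
  "A \<in> split_cartan \<longleftrightarrow> A $ 1 $ 2 = 0 \<and> A $ 2 $ 1 = 0 \<and> A $ 1 $ 1 \<noteq> 0 \<and> A $ 2 $ 2 \<noteq> 0"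
  for A :: "'a::field ^ 2 ^ 2"
  by (auto simp: split_cartan_def unit_group_def matrix_2_eq_iff dvd_field_iff)

lemma split_cartan_normalizer_iff:
  "A \<in> split_cartan_normalizer \<longleftrightarrow> A \<in> split_cartan \<or>
     A $ 1 $ 1 = 0 \<and> A $ 2 $ 2 = 0 \<and> A $ 1 $ 2 \<noteq> 0 \<and> A $ 2 $ 1 \<noteq> 0"
  for A :: "'a::field ^ 2 ^ 2"
proof -
  have "A \<in> (**) (vector [vector [0, 1], vector [1, 0]]) ` split_cartan \<longleftrightarrow>
      A $ 1 $ 1 = 0 \<and> A $ 2 $ 2 = 0 \<and> A $ 1 $ 2 \<noteq> 0 \<and> A $ 2 $ 1 \<noteq> 0" (is "?L \<longleftrightarrow> ?R")
  proof
    assume ?R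
    \<comment> \<open>Left multiplication by the swap matrix exchanges rows, so the diagonal factor
      is \<open>A\<close> with its rows exchanged.\<close>
    let ?B = "vector [vector [A $ 2 $ 1, 0], vector [0, A $ 1 $ 2]] :: 'a ^ 2 ^ 2"
    have "?B \<in> split_cartan" "A = vector [vector [0, 1], vector [1, 0]] ** ?B"
      using \<open>?R\<close> by (auto simp: split_cartan_iff matrix_2_eq_iff matrix_mult_2_nth)
    then show ?L
      by blast
  qed (auto simp: split_cartan_iff matrix_mult_2_nth)
  then show ?thesis
    by (simp add: split_cartan_normalizer_def)
qed

lemma (in group) derived_eq_singleton_of_commute:
  assumes "subgroup H G" "\<And>x y. x \<in> H \<Longrightarrow> y \<in> H \<Longrightarrow> x \<otimes> y = y \<otimes> x"
  shows "derived G H = {\<one>}"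
proof -
  have "comm_group (G\<lparr>carrier := H\<rparr>)"
    using subgroup_imp_group[OF assms(1)] assms(2) by (auto intro: group.group_comm_groupI)
  then show ?thesis
    using comm_group.derived_eq_singleton[of "G\<lparr>carrier := H\<rparr>" H] derived_consistent[OF _ assms(1), of H]
    by simp
qed

text \<open>A third element \<open>x\<close> rules out \<open>p = 2\<close>, the only prime for
  which \<open>- 1 = 1\<close>.\<close>

lemma minus_one_neq_one_mod_ring:
  assumes "x \<noteq> 0" "x \<noteq> (1 :: 'p::prime_card mod_ring)"
  shows "(- 1 :: 'p mod_ring) \<noteq> 1"
proof
  assume "(- 1 :: 'p mod_ring) = 1"
  then have "of_nat 2 = (0 :: 'p mod_ring)"
    by (metis add.right_inverse of_nat_numeral one_add_one)
  then have "CARD('p) dvd 2"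
    by (rule of_nat_0_mod_ring_dvd)
  then have "CARD('p) \<le> 2"
    by (simp add: dvd_imp_le)
  moreover have "card {0, 1, x} \<le> CARD('p mod_ring)"
    by (rule card_mono) auto
  ultimately show False
    using assms by (simp add: CARD_mod_ring)
qed

lemma order_unit_group: "Coset.order (unit_group :: 'a::{field,finite} monoid) = CARD('a) - 1"
proof -
  have "carrier (unit_group :: 'a monoid) = UNIV - {0}"
    by (auto simp: unit_group_def dvd_field_iff)
  then show ?thesis
    by (simp add: Coset.order_def card_Diff_singleton)
qed

section \<open>Bounding the order of the abelianization\<close>

context
  fixes G :: "('a::{field,finite} ^ 2 ^ 2) set"
  assumes G: "subgroup G GL2" and GN: "G \<subseteq> split_cartan_normalizer"
    and nontriv: "derived GL2 G \<noteq> {mat 1}"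
begin

text \<open>Diagonal matrices commute, so otherwise the derived subgroup would be trivial.\<close>

lemma antidiagonal_exists: "\<exists>\<gamma>\<in>G. \<gamma> \<notin> split_cartan"
proof (rule ccontr)
  assume "\<not> ?thesis"
  then have "x \<otimes>\<^bsub>GL2\<^esub> y = y \<otimes>\<^bsub>GL2\<^esub> x" if "x \<in> G" "y \<in> G" for x y
    using that by (auto simp: GL2_def matrix_2_eq_iff matrix_mult_2_nth split_cartan_iff)
  then have "derived GL2 G = {\<one>\<^bsub>GL2\<^esub>}"
    by (intro group.derived_eq_singleton_of_commute[OF group_GL2 G])
  then show False
    using nontriv by (simp add: GL2_def)
qed

text \<open>Over the field of two elements the normalizer contains only the identity and the swap
  matrix, which commute. This is how \<open>p = 2\<close> gets excluded.\<close>

lemma nontrivial_unit_exists: "\<exists>x::'a. x \<noteq> 0 \<and> x \<noteq> 1"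
proof (rule ccontr)
  assume "\<not> ?thesis"
  then have zero_or_one: "x = 0 \<or> x = 1" for x :: 'a
    by auto
  have "A $ 1 $ 2 = A $ 2 $ 1 \<and> A $ 1 $ 1 = A $ 2 $ 2" if "A \<in> G" for A
  proof -
    have "A \<in> split_cartan_normalizer"
      using that GN by auto
    then show ?thesis
      using zero_or_one[of "A $ 1 $ 1"] zero_or_one[of "A $ 2 $ 2"]
        zero_or_one[of "A $ 1 $ 2"] zero_or_one[of "A $ 2 $ 1"]
      unfolding split_cartan_normalizer_iff split_cartan_iff by metis
  qed
  then have "x \<otimes>\<^bsub>GL2\<^esub> y = y \<otimes>\<^bsub>GL2\<^esub> x" if "x \<in> G" "y \<in> G" for x y
    using that by (simp add: GL2_def matrix_2_eq_iff matrix_mult_2_nth algebra_simps)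
  then have "derived GL2 G = {\<one>\<^bsub>GL2\<^esub>}"
    by (intro group.derived_eq_singleton_of_commute[OF group_GL2 G])
  then show False
    using nontriv by (simp add: GL2_def)
qed

text \<open>The commutator of a diagonal \<open>c\<close> with \<open>\<gamma>\<close> is diagonal
  with upper left entry \<open>c $ 1 $ 1 / c $ 2 $ 2\<close>. Together with \<open>c $ 2 $ 2\<close>
  it recovers \<open>c\<close>, so \<open>?f\<close> is injective.\<close>

lemma card_diagonal_part_le:
  "card (G \<inter> split_cartan) \<le> (CARD('a) - 1) * card (derived GL2 G)"
proof -
  interpret GL: group "GL2 :: ('a ^ 2 ^ 2) monoid" by (rule group_GL2)
  obtain \<gamma> where \<gamma>: "\<gamma> \<in> G" "\<gamma> \<notin> split_cartan"
    using antidiagonal_exists by blast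
  then have \<gamma>': "\<gamma> $ 1 $ 1 = 0" "\<gamma> $ 2 $ 2 = 0" "\<gamma> $ 1 $ 2 \<noteq> 0"
    using GN by (auto simp: split_cartan_normalizer_iff)
  have carr: "x \<in> carrier GL2" if "x \<in> G" for x
    using that G subgroup.mem_carrier by metis
  let ?comm = "\<lambda>c. c \<otimes>\<^bsub>GL2\<^esub> \<gamma> \<otimes>\<^bsub>GL2\<^esub> inv\<^bsub>GL2\<^esub> c \<otimes>\<^bsub>GL2\<^esub> inv\<^bsub>GL2\<^esub> \<gamma>"
  let ?f = "\<lambda>c. (c $ 2 $ 2, ?comm c)"
  \<comment> \<open>Multiplying the commutator on the right by \<open>\<gamma>\<close> and then
    \<open>c\<close> cancels both inverses, so no inverse matrix has to be computed.\<close>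
  have conj: "(?comm c ** \<gamma>) $ 1 $ 2 * c $ 2 $ 2 = c $ 1 $ 1 * \<gamma> $ 1 $ 2"
    if c: "c \<in> G \<inter> split_cartan" for c
  proof -
    have "?comm c \<otimes>\<^bsub>GL2\<^esub> \<gamma> \<otimes>\<^bsub>GL2\<^esub> c = c \<otimes>\<^bsub>GL2\<^esub> \<gamma>"
      using carr \<gamma> c by (simp add: GL.m_assoc)
    then have "(?comm c ** \<gamma> ** c) $ 1 $ 2 = (c ** \<gamma>) $ 1 $ 2"
      by (simp add: GL2_def)
    then show ?thesis
      using c \<gamma>' unfolding matrix_mult_2_nth[of _ c] matrix_mult_2_nth[of c]
      by (simp add: split_cartan_iff)
  qed
  have "inj_on ?f (G \<inter> split_cartan)"
  proof (rule inj_onI)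
    fix c d assume c: "c \<in> G \<inter> split_cartan" and d: "d \<in> G \<inter> split_cartan" and eq: "?f c = ?f d"
    have "c $ 1 $ 1 * \<gamma> $ 1 $ 2 = d $ 1 $ 1 * \<gamma> $ 1 $ 2"
      using conj[OF c] conj[OF d] eq unfolding prod.inject by metis
    then show "c = d"
      using c d eq \<gamma>' by (simp add: matrix_2_eq_iff split_cartan_iff)
  qed
  moreover have "?f ` (G \<inter> split_cartan) \<subseteq> (UNIV - {0}) \<times> derived GL2 G"
    using \<gamma> by (auto simp: split_cartan_iff derived_def intro!: generate.incl)
  moreover have "finite ((UNIV - {0 :: 'a}) \<times> derived GL2 G)"
    by simp
  ultimately have "card (G \<inter> split_cartan) \<le> card ((UNIV - {0 :: 'a}) \<times> derived GL2 G)"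
    by (rule card_inj_on_le)
  then show ?thesis
    by (simp add: card_cartesian_product card_Diff_singleton)
qed

text \<open>A product of two antidiagonal matrices is diagonal, so left multiplication by
  \<open>\<gamma>\<close> injects the antidiagonal part into the diagonal part.\<close>

lemma card_le_twice_card_diagonal_part:
  "card G \<le> 2 * card (G \<inter> split_cartan)"
proof -
  interpret GL: group "GL2 :: ('a ^ 2 ^ 2) monoid" by (rule group_GL2)
  obtain \<gamma> where \<gamma>: "\<gamma> \<in> G" "\<gamma> \<notin> split_cartan"
    using antidiagonal_exists by blast
  have "inj_on ((\<otimes>\<^bsub>GL2\<^esub>) \<gamma>) (G - split_cartan)"
    using G \<gamma> by (intro inj_onI) (metis DiffD1 GL.Units_eq GL.Units_l_cancel subgroup.mem_carrier)
  moreover have "(\<otimes>\<^bsub>GL2\<^esub>) \<gamma> ` (G - split_cartan) \<subseteq> G \<inter> split_cartan"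
  proof -
    have "\<gamma> ** x \<in> split_cartan" if "x \<in> G - split_cartan" for x
    proof -
      have "x \<in> split_cartan_normalizer" "\<gamma> \<in> split_cartan_normalizer"
        using that \<gamma> GN by auto
      then show ?thesis
        using that \<gamma> by (auto simp: split_cartan_normalizer_iff split_cartan_iff[of "_ ** _"] matrix_mult_2_nth)
    qed
    moreover have "\<gamma> \<otimes>\<^bsub>GL2\<^esub> x \<in> G" if "x \<in> G" for x
      using that \<gamma> G by (metis subgroup.m_closed)
    ultimately show ?thesis
      by (auto simp: GL2_def)
  qed
  ultimately have "card (G - split_cartan) \<le> card (G \<inter> split_cartan)"
    by (rule card_inj_on_le) simp
  then show ?thesis
    using card_Int_Diff[of G split_cartan] by simp
qed

text \<open>Lagrange's theorem and the two preceding bounds, after cancelling the positive order of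
  the derived subgroup.\<close>

lemma order_abelianization_le:
  "Coset.order ((GL2\<lparr>carrier := G\<rparr>) Mod derived GL2 G) \<le> 2 * (CARD('a) - 1)"
proof -
  interpret GL: group "GL2 :: ('a ^ 2 ^ 2) monoid" by (rule group_GL2)
  let ?D = "derived GL2 G" and ?H = "GL2\<lparr>carrier := G\<rparr>"
  interpret H: group ?H
    by (rule GL.subgroup_imp_group[OF G])
  have D: "subgroup ?D ?H"
    using GL.derived_subgroup_is_normal[OF G] normal_imp_subgroup by blast
  have pos: "card ?D > 0"
    using subgroup.one_closed[OF D] by (auto simp: card_gt_0_iff)
  have "Coset.order (?H Mod ?D) * card ?D = card G"
    using H.lagrange[OF D] by (simp add: Coset.order_def FactGroup_def)
  also have "card G \<le> 2 * ((CARD('a) - 1) * card ?D)"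
    using card_le_twice_card_diagonal_part card_diagonal_part_le by linarith
  finally show ?thesis
    using pos by (simp add: mult.assoc[symmetric])
qed

end

section \<open>The determinant on the abelianization\<close>

theorem theorem5p12:
  fixes G :: "('p::prime_card mod_ring ^ 2 ^ 2) set"
  assumes "subgroup G GL2"
    and "G \<subseteq> split_cartan_normalizer"
    and "det ` G = carrier unit_group"
    and "derived GL2 G \<noteq> {mat 1}"
  shows "((GL2\<lparr>carrier := G\<rparr>) Mod (derived GL2 G) \<cong> (unit_group :: 'p mod_ring monoid) \<or>
          (GL2\<lparr>carrier := G\<rparr>) Mod (derived GL2 G)
            \<cong> (unit_group :: 'p mod_ring monoid) \<times>\<times> integer_mod_group 2 \<or>
          (GL2\<lparr>carrier := G\<rparr>) Mod (derived GL2 G) \<cong> integer_mod_group (2 * (CARD('p) - 1))) \<and>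
         ((\<exists>g\<in>G. trace g = 0 \<and> det g = - 1) \<longrightarrow>
          (GL2\<lparr>carrier := G\<rparr>) Mod (derived GL2 G) \<cong> (unit_group :: 'p mod_ring monoid) \<or>
          (GL2\<lparr>carrier := G\<rparr>) Mod (derived GL2 G)
            \<cong> (unit_group :: 'p mod_ring monoid) \<times>\<times> integer_mod_group 2)"
proof -
  let ?U = "unit_group :: 'p mod_ring monoid"
  let ?H = "GL2\<lparr>carrier := G\<rparr>" and ?D = "derived GL2 G"
  let ?A = "?H Mod ?D"
  interpret GL: group "GL2 :: ('p mod_ring ^ 2 ^ 2) monoid" by (rule group_GL2)
  interpret U: comm_group ?U by (rule comm_group_unit_group)
  interpret A: comm_group ?A
    by (rule GL.derived_quot_of_subgroup_is_comm_group[OF assms(1)])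
  interpret H: group ?H
    by (rule GL.subgroup_imp_group[OF assms(1)])
  have D: "?D \<lhd> ?H"
    by (rule GL.derived_subgroup_is_normal[OF assms(1)])
  interpret det: group_hom ?H ?U det
  proof unfold_locales
    show "det \<in> hom ?H ?U"
      using assms(3) by (auto simp: hom_def det_mul GL2_def unit_group_def)
  qed
  \<comment> \<open>The target is commutative, so commutators have determinant 1 and
    \<open>det\<close> factors through the quotient as \<open>\<phi>\<close>.\<close>
  have "?D \<subseteq> kernel ?H ?U det"
  proof -
    have "?D \<subseteq> G"
      by (rule GL.derived_incl[OF subset_refl assms(1)])
    moreover have "det ` ?D = {\<one>\<^bsub>?U\<^esub>}"
      using det.derived_img[of G] U.derived_eq_singleton[of "det ` G"] assms(3)
        GL.derived_consistent[OF subset_refl assms(1)]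
      by simp
    ultimately show ?thesis
      by (auto simp: kernel_def)
  qed
  then obtain \<phi> where \<phi>: "\<phi> \<in> hom ?A ?U" "\<And>x. x \<in> G \<Longrightarrow> \<phi> (?D #>\<^bsub>?H\<^esub> x) = det x"
    using det.FactGroup_universal_kernel[OF D] by auto
  interpret \<phi>: group_hom ?A ?U \<phi>
    by unfold_locales (rule \<phi>(1))
  have onto: "\<phi> ` carrier ?A = carrier ?U"
    using \<phi>(2) assms(3) by (simp add: carrier_FactGroup image_image)
  have finU: "finite (carrier ?U)"
    by simp
  have ordU: "Coset.order ?U = CARD('p) - 1"
    by (simp add: order_unit_group CARD_mod_ring)
  have posU: "Coset.order ?U > 0"
    using U.order_gt_0_iff_finite finU by blast
  \<comment> \<open>The left side is the order of \<open>?A\<close>, because \<open>\<phi>\<close>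
    is onto.\<close>
  have "card (kernel ?A ?U \<phi>) * Coset.order ?U \<le> 2 * Coset.order ?U"
    using \<phi>.card_kernel_mult_order[OF onto] order_abelianization_le[OF assms(1,2,4)]
    by (simp add: order_unit_group)
  then have "card (kernel ?A ?U \<phi>) \<le> 2"
    using posU by simp
  moreover have "card (kernel ?A ?U \<phi>) > 0"
    using \<phi>.subgroup_kernel by (metis A.order_gt_0_iff_finite \<phi>.card_kernel_mult_order finite gr0I mult_is_0 onto)
  ultimately consider "card (kernel ?A ?U \<phi>) = 1" | "card (kernel ?A ?U \<phi>) = 2"
    by linarith
  then show ?thesis
  proof cases
    case 1
    then have "kernel ?A ?U \<phi> = {\<one>\<^bsub>?A\<^esub>}"
      using subgroup.one_closed[OF \<phi>.subgroup_kernel] by (metis card_1_singletonE singletonD)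
    then have "\<phi> \<in> iso ?A ?U"
      using iso_kernel_image[OF A.group_axioms U.group_axioms] \<phi>(1) onto by blast
    then show ?thesis
      by (auto simp: is_iso_def)
  next
    case 2
    \<comment> \<open>The witness is the class of \<open>g\<close>: its square is trivial, while its
      image \<open>- 1\<close> differs from 1. This contradicts the clause on involutions in the
      cyclic alternative.\<close>
    have "\<exists>x\<in>carrier ?A. x \<otimes>\<^bsub>?A\<^esub> x = \<one>\<^bsub>?A\<^esub> \<and> \<phi> x \<noteq> \<one>\<^bsub>?U\<^esub>"
      if g: "g \<in> G" "trace g = 0" "det g = - 1" for g
    proof -
      have "(?D #>\<^bsub>?H\<^esub> g) \<otimes>\<^bsub>?A\<^esub> (?D #>\<^bsub>?H\<^esub> g) = ?D #>\<^bsub>?H\<^esub> (g \<otimes>\<^bsub>?H\<^esub> g)"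
        using normal.rcos_sum[OF D] g by simp
      also have "g \<otimes>\<^bsub>?H\<^esub> g = \<one>\<^bsub>?H\<^esub>"
        using square_eq_one_of_trace_det g by (simp add: GL2_def)
      also have "?D #>\<^bsub>?H\<^esub> \<one>\<^bsub>?H\<^esub> = \<one>\<^bsub>?A\<^esub>"
        using H.coset_mult_one[of ?D] D subgroup.subset[OF normal_imp_subgroup] by (metis one_FactGroup)
      finally have "(?D #>\<^bsub>?H\<^esub> g) \<otimes>\<^bsub>?A\<^esub> (?D #>\<^bsub>?H\<^esub> g) = \<one>\<^bsub>?A\<^esub>" .
      moreover have "\<phi> (?D #>\<^bsub>?H\<^esub> g) \<noteq> \<one>\<^bsub>?U\<^esub>"
        using nontrivial_unit_exists[OF assms(1,2,4)] minus_one_neq_one_mod_ring \<phi>(2) g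
        by (auto simp: unit_group_def)
      moreover have "?D #>\<^bsub>?H\<^esub> g \<in> carrier ?A"
        using g by (auto simp: carrier_FactGroup)
      ultimately show ?thesis
        by blast
    qed
    then show ?thesis
      using cyclic_extension_of_order_two[OF A.comm_group_axioms \<phi>.group_hom_axioms onto finU cyclic_unit_group 2]
      unfolding ordU by blast
  qed
qed

end
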